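(* Let $Y\in\{\pm1\}$ and $\mathbf{X}=(X_1,\dots,X_n)\in\{\pm1\}^n$ be random variables with $\mathbb{P}(X_i=Y)=p_i\in(0,1)$ for $i=1,\dots,n$, satisfying the following two assumptions: (Independence) the random variables $X_1,\dots,X_n$ are mutually independent; (Unbiased truth) $\mathbb{P}(Y=+1)=\mathbb{P}(Y=-1)=\tfrac12$. Put $$w_i=\log\frac{p_i}{1-p_i},\qquad \Phi=\sum_{i=1}^n\left(p_i-\tfrac12\right)w_i=\sum_{i=1}^n\left(p_i-\tfrac12\right)\log\frac{p_i}{1-p_i},$$ and let $f^{\mathrm{OPT}}:\{\pm1\}^n\to\{\pm1\}$ be the Nitzan-Paroush optimal decision rule $f^{\mathrm{OPT}}(\mathbf{x})=\operatorname{sign}\left(\sum_{i=1}^n w_ix_i\right)$. Then (i) $\displaystyle \mathbb{P}\left(f^{\mathrm{OPT}}(\mathbf{X})\neq Y\right)\le \exp\left(-\tfrac12\Phi\right)$; (ii) $\displaystyle \mathbb{P}\left(f^{\mathrm{OPT}}(\mathbf{X})\neq Y\right)\ge \frac{3}{4\left[1+\exp\left(2\Phi+4\sqrt{\Phi}\right)\right]}$.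
   Context: An agent predicts $Y$ from the inputs $X_1,\dots,X_n$ of $n$ experts; $p_i$ is the (known) competence of expert $i$, $\Phi$ is called the committee potential, and $f^{\mathrm{OPT}}$ is the weighted majority rule of Nitzan and Paroush. Ties are counted as errors: the event $\{f^{\mathrm{OPT}}(\mathbf{X})\neq Y\}$ is the event $\sum_{i=1}^n w_i\xi_i\le\frac12\sum_{i=1}^n w_i$, where $\xi_i=1$ if $X_i=Y$ and $\xi_i=0$ otherwise.
   Formalization: Independence is assumed of the events X_i=Y (experts being correct) instead of the votes X_i themselves; with independent votes (ii) fails, e.g. when Y is the majority of three independent fair votes (error 0). *)

theory Defs
  imports "HOL-Probability.Probability"
begin

text \<open>Experts are indexed by \<open>{1..n}\<close>; votes and truth are real numbers in \<open>{-1, 1}\<close>.\<close>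

definition weight :: "real \<Rightarrow> real" where
  "weight q = ln (q / (1 - q))"

definition potential :: "nat \<Rightarrow> (nat \<Rightarrow> real) \<Rightarrow> real" where
  "potential n p = (\<Sum>i=1..n. (p i - 1/2) * weight (p i))"

text \<open>
  Here \<open>sgn 0 = 0\<close>, which is not a possible value of the truth: a tied vote is always an error
  (made precise in \<open>opt_error_iff\<close> below).
\<close>

definition opt_rule :: "nat \<Rightarrow> (nat \<Rightarrow> real) \<Rightarrow> (nat \<Rightarrow> real) \<Rightarrow> real" where
  "opt_rule n p x = sgn (\<Sum>i=1..n. weight (p i) * x i)"

definition correct :: "(nat \<Rightarrow> 'a \<Rightarrow> real) \<Rightarrow> ('a \<Rightarrow> real) \<Rightarrow> nat \<Rightarrow> 'a \<Rightarrow> real" where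
  "correct X Y i \<omega> = (if X i \<omega> = Y \<omega> then 1 else 0)"

text \<open>
  Independence of the experts means independence of their being correct. It cannot mean
  unconditional independence of the votes \<open>X 1, \<dots>, X n\<close>: if \<open>Y\<close> is the majority of three independent
  fair votes, then every competence is \<open>3/4\<close> but the weighted majority never errs. It follows from
  independence of the votes conditional on the truth, when the competence of an expert does not
  depend on the truth; see \<open>indep_experts_if_conditionally_indep\<close>.
\<close>

definition indep_experts ::
    "'a measure \<Rightarrow> nat \<Rightarrow> (nat \<Rightarrow> 'a \<Rightarrow> real) \<Rightarrow> ('a \<Rightarrow> real) \<Rightarrow> bool" where
  "indep_experts M n X Y \<longleftrightarrow>
     prob_space.indep_vars M (\<lambda>_. borel :: real measure) (correct X Y) {1..n}"

lemma opt_error_iff: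
  assumes "Y \<omega> \<in> {-1, 1}" and "\<And>i. i \<in> {1..n} \<Longrightarrow> X i \<omega> \<in> {-1, 1}"
  shows "opt_rule n p (\<lambda>i. X i \<omega>) \<noteq> Y \<omega> \<longleftrightarrow>
    (\<Sum>i=1..n. weight (p i) * correct X Y i \<omega>) \<le> 1/2 * (\<Sum>i=1..n. weight (p i))"
proof -
  define S where "S = (\<Sum>i=1..n. weight (p i) * X i \<omega>)"
  have "weight (p i) * X i \<omega> =
      Y \<omega> * (2 * (weight (p i) * correct X Y i \<omega>) - weight (p i))" if "i \<in> {1..n}" for i
    using assms(1) assms(2)[OF that] by (auto simp: correct_def)
  then have "S = (\<Sum>i=1..n. Y \<omega> * (2 * (weight (p i) * correct X Y i \<omega>) - weight (p i)))"
    unfolding S_def by (intro sum.cong) auto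
  then have S: "S = Y \<omega> * (2 * (\<Sum>i=1..n. weight (p i) * correct X Y i \<omega>) - (\<Sum>i=1..n. weight (p i)))"
    by (simp only: sum_distrib_left sum_subtractf right_diff_distrib)
  have "opt_rule n p (\<lambda>i. X i \<omega>) \<noteq> Y \<omega> \<longleftrightarrow> Y \<omega> * S \<le> 0"
    using assms(1) unfolding opt_rule_def S_def[symmetric]
    by (elim insertE emptyE) (simp_all add: sgn_real_def not_less)
  also have "Y \<omega> * S = 2 * (\<Sum>i=1..n. weight (p i) * correct X Y i \<omega>) - (\<Sum>i=1..n. weight (p i))"
    using assms(1) unfolding S by auto
  finally show ?thesis
    by auto
qed

lemma indep_experts_if_conditionally_indep:
  fixes M :: "'a measure" and X :: "nat \<Rightarrow> 'a \<Rightarrow> real" and Y :: "'a \<Rightarrow> real" and p :: "nat \<Rightarrow> real"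
  defines "C \<equiv> \<lambda>y. uniform_measure M {\<omega> \<in> space M. Y \<omega> = y}"
  assumes "prob_space M"
    and Y: "Y \<in> borel_measurable M" "\<And>\<omega>. \<omega> \<in> space M \<Longrightarrow> Y \<omega> \<in> {-1, 1}"
    and X: "\<And>i. i \<in> {1..n} \<Longrightarrow> X i \<in> borel_measurable M"
    and unbiased: "\<And>y. y \<in> {-1, 1} \<Longrightarrow> measure M {\<omega> \<in> space M. Y \<omega> = y} = 1/2"
    and cond_indep: "\<And>y. y \<in> {-1, 1} \<Longrightarrow> prob_space.indep_vars (C y) (\<lambda>_. borel) X {1..n}"
    and cond_competence: "\<And>y i. \<lbrakk>y \<in> {-1, 1}; i \<in> {1..n}\<rbrakk> \<Longrightarrow>
      measure (C y) {\<omega> \<in> space M. X i \<omega> = y} = p i"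
  shows "indep_experts M n X Y"
proof -
  interpret prob_space M by fact
  let ?Y = "\<lambda>y. {\<omega> \<in> space M. Y \<omega> = y}"
  note [measurable] = Y(1) X
  have C: "measure (C y) A = 2 * measure M (?Y y \<inter> A)" if "y \<in> {-1, 1}" "A \<in> sets M" for y A
  proof -
    have "measure (C y) A = measure M (?Y y \<inter> A) / measure M (?Y y)"
      using that unbiased[of y] unfolding C_def
      by (intro measure_uniform_measure) (auto simp: emeasure_eq_measure)
    then show ?thesis
      using unbiased[OF that(1)] by (simp only:) simp
  qed
  have PC: "prob_space (C y)" if "y \<in> {-1, 1}" for y
    unfolding C_def using unbiased[OF that] by (intro prob_space_uniform_measure) (auto simp: emeasure_eq_measure)
  have sC: "sets (C y) = sets M" "space (C y) = space M" for y by (auto simp: C_def)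
  have meas: "correct X Y i \<in> borel_measurable M" if [measurable]: "i \<in> {1..n}" for i
    unfolding correct_def by measurable
  have total: "measure M A = 1/2 * (measure (C 1) A + measure (C (-1)) A)" if "A \<in> sets M" for A
  proof -
    have "A = (?Y 1 \<inter> A) \<union> (?Y (-1) \<inter> A)"
      using Y(2) sets.sets_into_space[OF that] by auto
    then have "measure M A = measure M (?Y 1 \<inter> A) + measure M (?Y (-1) \<inter> A)"
      using that by (subst finite_measure_Union[symmetric]) auto
    then show ?thesis using C that by simp
  qed
  have CY: "measure (C y) A = measure (C y) B"
    if "y \<in> {-1, 1}" "A \<in> sets M" "B \<in> sets M" "?Y y \<inter> A = ?Y y \<inter> B" for y A B
    using that C by simp
  let ?V = "\<lambda>y i \<omega>. if X i \<omega> = y then 1 else 0 :: real"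
  have V: "prob_space.indep_vars (C y) (\<lambda>_. borel) (?V y) {1..n}" if "y \<in> {-1, 1}" for y
    by (rule prob_space.indep_vars_compose2[OF PC[OF that] cond_indep[OF that],
          where Y = "\<lambda>i x. if x = y then 1 else 0 :: real"]) auto
  have Vmeas: "?V y i -` B \<inter> space M \<in> sets M" if "i \<in> {1..n}" "B \<in> sets borel" for y i B
    using that by measurable
  let ?g = "\<lambda>i B. (if (1::real) \<in> B then p i else 0) + (if (0::real) \<in> B then 1 - p i else 0)"
  have marg: "measure (C y) (?V y i -` B \<inter> space M) = ?g i B"
    if y: "y \<in> {-1, 1}" and i: "i \<in> {1..n}" for y i B
  proof -
    interpret c: prob_space "C y" by (rule PC[OF y])
    let ?E = "{\<omega> \<in> space M. X i \<omega> = y}"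
    have E: "?E \<in> sets (C y)" unfolding sC using i by measurable
    have compl: "measure (C y) (space M - ?E) = 1 - p i"
      using c.prob_compl[OF E] cond_competence[OF y i] by (simp add: sC)
    have "?V y i -` B \<inter> space M =
      (if 1 \<in> B then if 0 \<in> B then space M else ?E else if 0 \<in> B then space M - ?E else {})"
      by (auto split: if_splits)
    then show ?thesis
      using compl cond_competence[OF y i] c.prob_space by (auto simp: sC)
  qed
  have same: "measure (C y) (\<Inter>j\<in>J. correct X Y j -` B j \<inter> space M) = (\<Prod>j\<in>J. ?g j (B j))"
    if y: "y \<in> {-1, 1}" and J: "J \<noteq> {}" "J \<subseteq> {1..n}" "finite J" and B: "\<And>j. j \<in> J \<Longrightarrow> B j \<in> sets borel"
    for y J B
  proof -
    interpret c: prob_space "C y" by (rule PC[OF y])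
    have "measure (C y) (\<Inter>j\<in>J. correct X Y j -` B j \<inter> space M) =
        measure (C y) (\<Inter>j\<in>J. ?V y j -` B j \<inter> space M)"
    proof (rule CY[OF y])
      show "(\<Inter>j\<in>J. correct X Y j -` B j \<inter> space M) \<in> sets M"
        using J B meas by (intro sets.finite_INT) (auto intro: measurable_sets)
      show "(\<Inter>j\<in>J. ?V y j -` B j \<inter> space M) \<in> sets M"
        using J B Vmeas by (intro sets.finite_INT) auto
    qed (use J in \<open>auto simp: correct_def\<close>)
    also have "\<dots> = (\<Prod>j\<in>J. measure (C y) (?V y j -` B j \<inter> space M))"
      using V[OF y] J B unfolding c.indep_vars_def2 sC
      by (intro c.indep_setsD[where I = "{1..n}"]) auto
    also have "\<dots> = (\<Prod>j\<in>J. ?g j (B j))"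
      using J by (intro prod.cong refl marg[OF y]) auto
    finally show ?thesis .
  qed
  have joint: "prob (\<Inter>j\<in>J. correct X Y j -` B j \<inter> space M) = (\<Prod>j\<in>J. ?g j (B j))"
    if J: "J \<noteq> {}" "J \<subseteq> {1..n}" "finite J" and B: "\<And>j. j \<in> J \<Longrightarrow> B j \<in> sets borel" for J B
  proof -
    have "(\<Inter>j\<in>J. correct X Y j -` B j \<inter> space M) \<in> sets M"
      using J B meas by (intro sets.finite_INT) (auto intro: measurable_sets)
    from total[OF this] show ?thesis
      using same[OF _ J B] by simp
  qed
  show ?thesis
    unfolding indep_experts_def indep_vars_def2
  proof (intro conjI ballI meas indep_setsI)
    fix A and J :: "nat set"
    assume J: "J \<noteq> {}" "J \<subseteq> {1..n}" "finite J"
      and "\<forall>j\<in>J. A j \<in> {correct X Y j -` B \<inter> space M |B. B \<in> sets borel}"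
    then obtain B where B: "\<And>j. j \<in> J \<Longrightarrow> B j \<in> sets borel"
      and A: "\<And>j. j \<in> J \<Longrightarrow> A j = correct X Y j -` B j \<inter> space M"
      by simp metis
    have "prob (\<Inter>j\<in>J. A j) = (\<Prod>j\<in>J. ?g j (B j))"
      using joint[OF J B] A by simp
    also have "\<dots> = (\<Prod>j\<in>J. prob (A j))"
      using joint[of "{_}"] J B A by (intro prod.cong refl) auto
    finally show "prob (\<Inter>j\<in>J. A j) = (\<Prod>j\<in>J. prob (A j))" .
  qed (use meas in \<open>auto intro: measurable_sets\<close>)
qed

end

theory Submission
  imports Defs
begin

text \<open>
  Only the set \<open>J\<close> of correct experts matters. With \<open>P(J)\<close> its probability and
  \<open>s(J) = \<Sum>\<^bsub>i\<in>J\<^esub> w\<^sub>i - \<Sum>\<^bsub>i\<notin>J\<^esub> w\<^sub>i\<close> the weighted margin, an error is the event \<open>s \<le> 0\<close>.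
  Writing \<open>w\<^sub>i = 2 u\<^sub>i\<close>, the contribution of expert \<open>i\<close> to \<open>\<Phi>\<close> is \<open>u\<^sub>i tanh u\<^sub>i\<close>.

  Upper bound: \<open>P(s \<le> 0) \<le> E exp (- s/2) = \<Prod>i. 1 / cosh u\<^sub>i\<close>, and \<open>ln (cosh u) \<ge> u tanh u / 2\<close>.

  Lower bound: swapping right and wrong gives \<open>P(J) = exp (s(J)) P(I - J)\<close>, hence
  \<open>P(\<bar>s\<bar> \<le> t) \<le> (1 + exp t) P(s \<le> 0)\<close>. Since \<open>s\<close> has mean \<open>2 \<Phi>\<close> and, by
  \<open>u \<le> sinh u cosh u\<close>, variance at most \<open>4 \<Phi>\<close>, Chebyshev bounds the left-hand side from
  below by \<open>3/4\<close> for \<open>t = 2 \<Phi> + 4 sqrt \<Phi>\<close>.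
\<close>

section \<open>One-expert inequalities in hyperbolic form\<close>

text \<open>With \<open>u\<close> half the log-odds, \<open>q - 1/2\<close> becomes
  \<open>tanh u / 2\<close> and \<open>q * (1 - q)\<close> becomes
  \<open>1 / (4 * (cosh u)\<^sup>2)\<close>.\<close>

lemma weight_paramE:
  assumes "q \<in> {0<..<1}"
  obtains u where "weight q = 2 * u" "q = exp u / (2 * cosh u)" "1 - q = exp (- u) / (2 * cosh u)"
proof
  let ?u = "weight q / 2"
  have "exp ?u * exp ?u = q / (1 - q)"
    unfolding exp_add[symmetric] using assms by (simp add: weight_def)
  \<comment> \<open>Hence \<open>q * (exp ?u + exp (- ?u))\<close> collapses to
    \<open>exp ?u\<close>, and the sum in brackets is \<open>2 * cosh ?u\<close>.\<close>
  then have e: "q * exp (- ?u) = (1 - q) * exp ?u"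
    using assms by (simp add: exp_minus field_simps)
  have "q * (2 * cosh ?u) = exp ?u" "(1 - q) * (2 * cosh ?u) = exp (- ?u)"
    using e by (simp_all add: cosh_field_def algebra_simps)
  then show "q = exp ?u / (2 * cosh ?u)" "1 - q = exp (- ?u) / (2 * cosh ?u)"
    by (simp_all add: eq_divide_eq)
qed simp

lemma exp_minus_cosh: "exp u - cosh u = sinh u" for u :: real
  using cosh_plus_sinh[of u] by linarith

lemma le_sinh_mult_cosh: "u \<le> sinh u * cosh u" if "0 \<le> u" for u :: real
proof -
  have "2 * u \<le> sinh (2 * u)"
    using real_le_x_sinh[of "2 * u"] that by (simp add: sinh_field_def exp_minus)
  then show ?thesis
    by (simp add: sinh_double)
qed

text \<open>Both sides are even and vanish at 0; on the nonnegative axis their difference is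
  monotone by \<open>le_sinh_mult_cosh\<close>.\<close>

lemma half_mult_tanh_le_ln_cosh: "u * tanh u / 2 \<le> ln (cosh u)" for u :: real
proof -
  have *: "u * tanh u / 2 \<le> ln (cosh u)" if "0 \<le> u" for u :: real
  proof -
    let ?f = "\<lambda>x::real. ln (cosh x) - x * tanh x / 2"
    let ?f' = "\<lambda>x::real. (sinh x * cosh x - x) / (2 * (cosh x)\<^sup>2)"
    have "(?f has_real_derivative ?f' x) (at x)" for x
    proof (rule DERIV_cong)
      show "(?f has_real_derivative sinh x / cosh x - (tanh x + x * (1 - (tanh x)\<^sup>2)) / 2) (at x)"
        by (auto intro!: derivative_eq_intros)
      have "1 - (tanh x)\<^sup>2 = ((cosh x)\<^sup>2 - (sinh x)\<^sup>2) / (cosh x)\<^sup>2"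
        by (simp add: tanh_def power_divide diff_divide_distrib)
      then have sech: "1 - (tanh x)\<^sup>2 = 1 / (cosh x)\<^sup>2"
        by (simp only: hyperbolic_pythagoras)
      have "s / c - (s / c + x * (1 / c\<^sup>2)) / 2 = (s * c - x) / (2 * c\<^sup>2)" if "c \<noteq> 0" for s c :: real
        using that by (simp add: field_simps power2_eq_square)
      from this[OF cosh_real_nonzero]
      show "sinh x / cosh x - (tanh x + x * (1 - (tanh x)\<^sup>2)) / 2 = ?f' x"
        unfolding sech unfolding tanh_def .
    qed
    moreover have "0 \<le> ?f' x" if "0 \<le> x" for x
      using le_sinh_mult_cosh[OF that] by simp
    ultimately have "\<exists>y. (?f has_real_derivative y) (at x) \<and> 0 \<le> y" if "0 \<le> x" for x
      using that by (intro exI[of _ "?f' x"] conjI)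
    then have "?f 0 \<le> ?f u"
      by (rule DERIV_nonneg_imp_nondecreasing[OF that])
    then show ?thesis by simp
  qed
  show ?thesis
    using *[of "\<bar>u\<bar>"] by (cases "0 \<le> u") auto
qed

text \<open>Four times the left-hand side is the variance of one expert's contribution
  \<open>\<plusminus> weight q\<close> to the margin. In terms of \<open>u\<close> the claim is
  \<open>u * u / (cosh u)\<^sup>2 \<le> u * tanh u\<close>.\<close>

lemma variance_le_potential:
  assumes "q \<in> {0<..<1}"
  shows "q * (1 - q) * (weight q)\<^sup>2 \<le> (q - 1/2) * weight q"
proof -
  obtain u where u: "weight q = 2 * u" "q = exp u / (2 * cosh u)" "1 - q = exp (- u) / (2 * cosh u)"
    using weight_paramE[OF assms] .
  have "q * (1 - q) = 1 / (4 * (cosh u)\<^sup>2)"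
    unfolding u(3) unfolding u(2) by (simp add: power2_eq_square flip: exp_add)
  then have "q * (1 - q) * (weight q)\<^sup>2 = u * u / (cosh u)\<^sup>2"
    unfolding u(1) by (simp add: power2_eq_square)
  also have "\<dots> \<le> u * (sinh u * cosh u) / (cosh u)\<^sup>2"
    using le_sinh_mult_cosh[of u] le_sinh_mult_cosh[of "- u"]
    by (intro divide_right_mono) (cases "0 \<le> u"; auto intro: mult_left_mono mult_left_mono_neg)+
  also have "\<dots> = (sinh u / (2 * cosh u)) * (2 * u)"
    by (simp add: power2_eq_square)
  also have "sinh u / (2 * cosh u) = q - 1/2"
    unfolding u(2) exp_minus_cosh[symmetric] by (simp add: field_simps)
  finally show ?thesis
    by (simp add: u(1))
qed

corollary potential_term_nonneg:
  assumes "q \<in> {0<..<1}"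
  shows "0 \<le> (q - 1/2) * weight q"
  by (rule order_trans[OF _ variance_le_potential[OF assms]]) (use assms in auto)

text \<open>The left-hand side is the Hellinger affinity of the Bernoulli laws with parameters
  \<open>q\<close> and \<open>1 - q\<close>; it equals \<open>1 / cosh u\<close>.\<close>

lemma affinity_le_exp_potential:
  assumes "q \<in> {0<..<1}"
  shows "2 * sqrt (q * (1 - q)) \<le> exp (- (1/2) * ((q - 1/2) * weight q))"
proof -
  obtain u where u: "weight q = 2 * u" "q = exp u / (2 * cosh u)" "1 - q = exp (- u) / (2 * cosh u)"
    using weight_paramE[OF assms] .
  have "q * (1 - q) = (1 / (2 * cosh u))\<^sup>2"
    unfolding u(3) unfolding u(2) by (simp add: power2_eq_square flip: exp_add)
  then have "2 * sqrt (q * (1 - q)) = exp (- ln (cosh u))"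
    by (simp add: exp_minus inverse_eq_divide)
  also have "\<dots> \<le> exp (- (u * tanh u / 2))"
    using half_mult_tanh_le_ln_cosh[of u] by simp
  also have "u * tanh u / 2 = 1/2 * ((q - 1/2) * weight q)"
  proof -
    have "q - 1/2 = sinh u / (2 * cosh u)"
      unfolding u(2) exp_minus_cosh[symmetric] by (simp add: field_simps)
    then show ?thesis unfolding u(1) by (simp add: tanh_def mult.commute)
  qed
  finally show ?thesis by simp
qed

section \<open>The product distribution on sets of correct experts\<close>

definition config_prob :: "('i \<Rightarrow> real) \<Rightarrow> 'i set \<Rightarrow> 'i set \<Rightarrow> real" where
  "config_prob p I J = (\<Prod>i\<in>I. if i \<in> J then p i else 1 - p i)"

text \<open>This is the truth times the weighted vote when \<open>J\<close> is the set of correct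
  experts.\<close>

definition margin :: "('i \<Rightarrow> real) \<Rightarrow> 'i set \<Rightarrow> 'i set \<Rightarrow> real" where
  "margin w I J = (\<Sum>i\<in>I. if i \<in> J then w i else - w i)"

lemma config_prob_nonneg: "(\<And>i. i \<in> I \<Longrightarrow> p i \<in> {0<..<1}) \<Longrightarrow> 0 \<le> config_prob p I J"
  unfolding config_prob_def by (intro prod_nonneg) force

lemma config_prob_insert:
  assumes "finite I" "a \<notin> I" "J \<subseteq> I"
  shows "config_prob p (insert a I) (insert a J) = p a * config_prob p I J"
    and "config_prob p (insert a I) J = (1 - p a) * config_prob p I J"
  using assms by (auto simp: config_prob_def intro!: prod.cong)

lemma margin_insert:
  assumes "finite I" "a \<notin> I" "J \<subseteq> I"
  shows "margin w (insert a I) (insert a J) = margin w I J + w a"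
    and "margin w (insert a I) J = margin w I J - w a"
  using assms by (auto simp: margin_def intro!: sum.cong)

text \<open>Conditioning on whether expert \<open>a\<close> is right; this drives the inductions on
  \<open>I\<close>.\<close>

lemma sum_Pow_insert:
  fixes F :: "'b set \<Rightarrow> 'c::comm_monoid_add"
  assumes "finite I" "a \<notin> I"
  shows "(\<Sum>J\<in>Pow (insert a I). F J) = (\<Sum>J\<in>Pow I. F (insert a J) + F J)"
proof -
  have "(\<Sum>J\<in>Pow (insert a I). F J) = (\<Sum>J\<in>Pow I. F J) + (\<Sum>J\<in>insert a ` Pow I. F J)"
    unfolding Pow_insert using assms by (intro sum.union_disjoint) auto
  also have "(\<Sum>J\<in>insert a ` Pow I. F J) = (\<Sum>J\<in>Pow I. F (insert a J))"
    using assms(2) by (subst sum.reindex) (auto simp: inj_on_def)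
  finally show ?thesis by (simp add: sum.distrib add.commute)
qed

lemma sum_config_prob: "finite I \<Longrightarrow> (\<Sum>J\<in>Pow I. config_prob p I J) = 1"
proof (induction I rule: finite_induct)
  case (insert a I)
  then show ?case
    by (simp add: sum_Pow_insert config_prob_insert del: Pow_insert flip: distrib_right)
qed (simp add: config_prob_def)

definition mean_margin :: "('i \<Rightarrow> real) \<Rightarrow> ('i \<Rightarrow> real) \<Rightarrow> 'i set \<Rightarrow> real" where
  "mean_margin p w I = (\<Sum>i\<in>I. (2 * p i - 1) * w i)"

text \<open>A new expert shifts the deviation by \<open>2 * (1 - p a) * w a\<close> or
  \<open>- 2 * p a * w a\<close>. This shift has mean zero, so the cross terms cancel and the
  variances add up.\<close>

lemma margin_variance:
  "finite I \<Longrightarrow> (\<Sum>J\<in>Pow I. config_prob p I J * (margin w I J - mean_margin p w I)\<^sup>2) =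
    (\<Sum>i\<in>I. 4 * (p i * (1 - p i) * (w i)\<^sup>2))"
proof (induction I rule: finite_induct)
  case (insert a I)
  let ?m = "\<lambda>J. margin w I J - mean_margin p w I"
  have m: "mean_margin p w (insert a I) = (2 * p a - 1) * w a + mean_margin p w I"
    using insert.hyps by (simp add: mean_margin_def)
  have "(\<Sum>J\<in>Pow (insert a I). config_prob p (insert a I) J *
      (margin w (insert a I) J - mean_margin p w (insert a I))\<^sup>2) =
    (\<Sum>J\<in>Pow I. config_prob p I J * (?m J)\<^sup>2 +
       4 * (p a * (1 - p a) * (w a)\<^sup>2) * config_prob p I J)"
    unfolding sum_Pow_insert[OF insert.hyps] m using insert.hyps
    by (intro sum.cong refl)
      (simp add: config_prob_insert margin_insert algebra_simps power2_eq_square)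
  also have "\<dots> = (\<Sum>J\<in>Pow I. config_prob p I J * (?m J)\<^sup>2) + 4 * (p a * (1 - p a) * (w a)\<^sup>2)"
    by (simp add: sum.distrib sum_config_prob[OF insert.hyps(1)] flip: sum_distrib_left)
  finally show ?case using insert by simp
qed (simp add: margin_def mean_margin_def)

text \<open>Markov's inequality, used with \<open>exp (- s/2)\<close> for the upper bound and with
  the squared deviation from the mean for the lower one.\<close>

lemma markov_config:
  assumes "finite I" "\<And>i. i \<in> I \<Longrightarrow> p i \<in> {0<..<1}"
    and "\<And>J. J \<in> Pow I \<Longrightarrow> 0 \<le> g J" "\<And>J. J \<in> Pow I \<Longrightarrow> P J \<Longrightarrow> c \<le> g J"
  shows "c * (\<Sum>J\<in>{J \<in> Pow I. P J}. config_prob p I J) \<le> (\<Sum>J\<in>Pow I. config_prob p I J * g J)"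
proof -
  have nonneg: "0 \<le> config_prob p I J" for J
    by (rule config_prob_nonneg[OF assms(2)])
  have "c * (\<Sum>J\<in>{J \<in> Pow I. P J}. config_prob p I J) \<le> (\<Sum>J\<in>{J \<in> Pow I. P J}. config_prob p I J * g J)"
    unfolding sum_distrib_left
    using assms(4) nonneg by (intro sum_mono) (auto simp: mult.commute[of c] intro: mult_left_mono)
  also have "\<dots> \<le> (\<Sum>J\<in>Pow I. config_prob p I J * g J)"
    using assms(1,3) nonneg by (intro sum_mono2) auto
  finally show ?thesis .
qed

text \<open>The Chernoff parameter \<open>1/2\<close> makes every configuration contribute equally.\<close>

lemma config_prob_mult_exp_margin:
  assumes "\<And>i. i \<in> I \<Longrightarrow> p i \<in> {0<..<1}"
  shows "config_prob p I J * exp (- margin (weight \<circ> p) I J / 2) = (\<Prod>i\<in>I. sqrt (p i * (1 - p i)))"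
proof (cases "finite I")
  case True
  have "exp (- margin (weight \<circ> p) I J / 2) =
      (\<Prod>i\<in>I. exp (- (if i \<in> J then weight (p i) else - weight (p i)) / 2))"
    unfolding margin_def comp_def sum_negf[symmetric] sum_divide_distrib
    using True by (simp add: exp_sum)
  moreover have "(if i \<in> J then p i else 1 - p i) *
      exp (- (if i \<in> J then weight (p i) else - weight (p i)) / 2) = sqrt (p i * (1 - p i))"
    if i: "i \<in> I" for i
  proof -
    obtain u where u: "weight (p i) = 2 * u"
        "p i = exp u / (2 * cosh u)" "1 - p i = exp (- u) / (2 * cosh u)"
      using weight_paramE[OF assms[OF i]] .
    have "p i * (1 - p i) = (1 / (2 * cosh u))\<^sup>2"
      unfolding u(3) unfolding u(2) by (simp add: power2_eq_square flip: exp_add)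
    then have "sqrt (p i * (1 - p i)) = 1 / (2 * cosh u)"
      by simp
    moreover have "p i * exp (- u) = 1 / (2 * cosh u)"
      unfolding u(2) by (simp flip: exp_add)
    moreover have "(1 - p i) * exp u = 1 / (2 * cosh u)"
      unfolding u(3) by (simp flip: exp_add)
    ultimately show ?thesis by (simp add: u(1))
  qed
  ultimately show ?thesis
    unfolding config_prob_def by (simp flip: prod.distrib)
qed (simp add: config_prob_def margin_def)

lemma margin_Diff: "margin w I (I - J) = - margin w I J"
  unfolding margin_def sum_negf[symmetric] by (intro sum.cong) auto

text \<open>The product in \<open>config_prob_mult_exp_margin\<close> does not depend on
  \<open>J\<close>, and complementing \<open>J\<close> negates the margin.\<close>

lemma config_prob_complement:
  assumes "\<And>i. i \<in> I \<Longrightarrow> p i \<in> {0<..<1}"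
  shows "config_prob p I J = exp (margin (weight \<circ> p) I J) * config_prob p I (I - J)"
proof -
  let ?s = "margin (weight \<circ> p) I J"
  have "config_prob p I K * exp (- margin (weight \<circ> p) I K / 2) = (\<Prod>i\<in>I. sqrt (p i * (1 - p i)))" for K
    by (rule config_prob_mult_exp_margin[OF assms])
  from this[of J] this[of "I - J"]
  have "config_prob p I J * exp (- ?s / 2) = config_prob p I (I - J) * exp (?s / 2)"
    by (simp add: margin_Diff)
  then have "config_prob p I J * exp (- ?s / 2) * exp (?s / 2) =
      config_prob p I (I - J) * exp (?s / 2) * exp (?s / 2)"
    by (rule arg_cong)
  then show ?thesis
    unfolding mult.assoc exp_add[symmetric] by (simp add: mult.commute)
qed

section \<open>Bounds on the error probability\<close>

text \<open>The non-strict inequality counts ties as errors.\<close>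

definition error_prob :: "('i \<Rightarrow> real) \<Rightarrow> 'i set \<Rightarrow> real" where
  "error_prob p I = (\<Sum>J\<in>{J \<in> Pow I. margin (weight \<circ> p) I J \<le> 0}. config_prob p I J)"

lemma error_prob_upper:
  assumes "finite I" "\<And>i. i \<in> I \<Longrightarrow> p i \<in> {0<..<1}"
  shows "error_prob p I \<le> exp (- (1/2) * (\<Sum>i\<in>I. (p i - 1/2) * weight (p i)))"
proof -
  have "error_prob p I \<le> (\<Sum>J\<in>Pow I. config_prob p I J * exp (- margin (weight \<circ> p) I J / 2))"
    using markov_config[OF assms, where c = 1 and P = "\<lambda>J. margin (weight \<circ> p) I J \<le> 0"]
    unfolding error_prob_def by simp
  also have "\<dots> = (\<Sum>J\<in>Pow I. \<Prod>i\<in>I. sqrt (p i * (1 - p i)))"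
    by (intro sum.cong refl config_prob_mult_exp_margin assms(2))
  \<comment> \<open>The number of configurations is a power of 2, which supplies one factor 2 per
    expert.\<close>
  also have "\<dots> = (\<Prod>i\<in>I. 2 * sqrt (p i * (1 - p i)))"
    using assms(1) by (simp add: card_Pow prod.distrib)
  also have "\<dots> \<le> (\<Prod>i\<in>I. exp (- (1/2) * ((p i - 1/2) * weight (p i))))"
    using affinity_le_exp_potential assms(2) by (intro prod_mono) (fastforce simp: less_imp_le)
  also have "\<dots> = exp (- (1/2) * (\<Sum>i\<in>I. (p i - 1/2) * weight (p i)))"
    using assms(1) by (simp add: exp_sum sum_distrib_left)
  finally show ?thesis .
qed

text \<open>Small nonpositive margins are errors already; a positive margin up to \<open>t\<close>
  is at most \<open>exp t\<close> times as likely as its complement, which is an error.\<close>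

lemma small_margin_le_error_prob:
  assumes "finite I" "\<And>i. i \<in> I \<Longrightarrow> p i \<in> {0<..<1}"
  shows "(\<Sum>J\<in>{J \<in> Pow I. \<bar>margin (weight \<circ> p) I J\<bar> \<le> t}. config_prob p I J)
    \<le> (1 + exp t) * error_prob p I"
proof -
  let ?s = "margin (weight \<circ> p) I" and ?P = "config_prob p I"
  have nonneg: "0 \<le> ?P J" for J
    by (rule config_prob_nonneg[OF assms(2)])
  let ?A = "{J \<in> Pow I. \<bar>?s J\<bar> \<le> t \<and> ?s J \<le> 0}" and ?B = "{J \<in> Pow I. \<bar>?s J\<bar> \<le> t \<and> 0 < ?s J}"
  have fin: "finite ?A" "finite ?B" using assms(1) by auto
  have "{J \<in> Pow I. \<bar>?s J\<bar> \<le> t} = ?A \<union> ?B" by auto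
  then have "sum ?P {J \<in> Pow I. \<bar>?s J\<bar> \<le> t} = sum ?P ?A + sum ?P ?B"
    using fin by (simp only:) (rule sum.union_disjoint; auto)
  moreover have "sum ?P ?A \<le> error_prob p I"
    unfolding error_prob_def using assms(1) nonneg by (intro sum_mono2) auto
  moreover have "sum ?P ?B \<le> exp t * error_prob p I"
  proof -
    have "sum ?P ?B \<le> (\<Sum>J\<in>?B. exp t * ?P (I - J))"
    proof (rule sum_mono)
      fix J assume "J \<in> ?B"
      then have "exp (?s J) \<le> exp t" by auto
      then show "?P J \<le> exp t * ?P (I - J)"
        by (subst config_prob_complement[OF assms(2)]) (auto intro!: mult_right_mono nonneg)
    qed
    \<comment> \<open>Complementation is injective on subsets of \<open>I\<close>, so no error
      configuration is counted twice.\<close>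
    also have "\<dots> = exp t * sum ?P ((\<lambda>J. I - J) ` ?B)"
      by (subst sum.reindex) (auto simp: inj_on_def sum_distrib_left)
    also have "\<dots> \<le> exp t * error_prob p I"
      unfolding error_prob_def using assms(1) nonneg
      by (intro mult_left_mono sum_mono2) (auto simp: margin_Diff)
    finally show ?thesis .
  qed
  ultimately show ?thesis by (simp add: distrib_right)
qed

lemma error_prob_lower:
  fixes p :: "'i \<Rightarrow> real"
  assumes "finite I" "\<And>i. i \<in> I \<Longrightarrow> p i \<in> {0<..<1}"
  defines "\<Phi> \<equiv> \<Sum>i\<in>I. (p i - 1/2) * weight (p i)"
  shows "3 / (4 * (1 + exp (2 * \<Phi> + 4 * sqrt \<Phi>))) \<le> error_prob p I"
proof -
  let ?s = "margin (weight \<circ> p) I" and ?P = "config_prob p I" and ?t = "2 * \<Phi> + 4 * sqrt \<Phi>"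
  have \<Phi>: "0 \<le> \<Phi>"
    unfolding \<Phi>_def by (intro sum_nonneg potential_term_nonneg assms(2))
  have mean: "mean_margin p (weight \<circ> p) I = 2 * \<Phi>"
    unfolding mean_margin_def \<Phi>_def sum_distrib_left by (intro sum.cong) (auto simp: algebra_simps)
  let ?far = "{J \<in> Pow I. \<not> \<bar>?s J\<bar> \<le> ?t}" and ?near = "{J \<in> Pow I. \<bar>?s J\<bar> \<le> ?t}"
  have var: "(\<Sum>J\<in>Pow I. ?P J * (?s J - 2 * \<Phi>)\<^sup>2) \<le> 4 * \<Phi>"
    using sum_mono[of I "\<lambda>i. p i * (1 - p i) * (weight (p i))\<^sup>2"]
      variance_le_potential assms(2)
    unfolding mean[symmetric] margin_variance[OF assms(1)] unfolding \<Phi>_def sum_distrib_left[symmetric]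
    by simp
  \<comment> \<open>The standard deviation is at most \<open>2 * sqrt \<Phi>\<close>, so a far
    margin deviates from its mean \<open>2 * \<Phi>\<close> by at least twice that bound.\<close>
  have far: "sum ?P ?far \<le> 1/4"
  proof (cases "\<Phi> = 0")
    \<comment> \<open>Chebyshev would divide by 0 here. Instead the variance vanishes, so every
      configuration of nonzero margin has probability 0.\<close>
    case True
    have "(\<Sum>J\<in>Pow I. ?P J * (?s J)\<^sup>2) \<le> 0"
      using var True by simp
    then have "(\<Sum>J\<in>Pow I. ?P J * (?s J)\<^sup>2) = 0"
      by (intro order_antisym sum_nonneg mult_nonneg_nonneg config_prob_nonneg assms(2)) auto
    then have "\<forall>J\<in>Pow I. ?P J * (?s J)\<^sup>2 = 0"
      using assms(1) by (subst (asm) sum_nonneg_eq_0_iff)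
        (auto intro!: mult_nonneg_nonneg config_prob_nonneg assms(2))
    then have "sum ?P ?far = 0"
      using True by (intro sum.neutral) auto
    then show ?thesis by simp
  next
    case False
    have "16 * \<Phi> * sum ?P ?far \<le> (\<Sum>J\<in>Pow I. ?P J * (?s J - 2 * \<Phi>)\<^sup>2)"
    proof (rule markov_config[OF assms(1,2)])
      fix J assume "\<not> \<bar>?s J\<bar> \<le> ?t"
      then have "4 * sqrt \<Phi> \<le> \<bar>?s J - 2 * \<Phi>\<bar>"
        using \<Phi> by linarith
      then have "(4 * sqrt \<Phi>)\<^sup>2 \<le> \<bar>?s J - 2 * \<Phi>\<bar>\<^sup>2"
        by (intro power_mono) (use \<Phi> in auto)
      then show "16 * \<Phi> \<le> (?s J - 2 * \<Phi>)\<^sup>2"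
        using \<Phi> by (simp add: power_mult_distrib)
    qed auto
    then have "16 * \<Phi> * sum ?P ?far \<le> 16 * \<Phi> * (1/4)"
      using var by simp
    then show ?thesis
      using \<Phi> False by (subst (asm) mult_le_cancel_left_pos) auto
  qed
  have "1 = sum ?P ?near + sum ?P ?far"
    unfolding sum_config_prob[OF assms(1), of p, symmetric] using assms(1)
    by (subst sum.union_disjoint[symmetric]) (auto intro!: sum.cong)
  moreover have "sum ?P ?near \<le> (1 + exp ?t) * error_prob p I"
    by (rule small_margin_le_error_prob[OF assms(1,2)])
  ultimately have "3/4 \<le> (1 + exp ?t) * error_prob p I"
    using far by linarith
  then show ?thesis
    by (simp add: field_simps add_pos_pos)
qed

section \<open>Transfer to the probability space\<close>

lemma prob_correct_set:
  assumes "prob_space M"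
    and [measurable]: "Y \<in> borel_measurable M" "\<And>i. i \<in> I \<Longrightarrow> X i \<in> borel_measurable M"
    and p: "\<And>i. i \<in> I \<Longrightarrow> measure M {\<omega> \<in> space M. X i \<omega> = Y \<omega>} = p i"
    and indep: "prob_space.indep_vars M (\<lambda>_. borel :: real measure) (correct X Y) I"
    and "finite I" "J \<subseteq> I"
  shows "measure M {\<omega> \<in> space M. {i \<in> I. X i \<omega> = Y \<omega>} = J} = config_prob p I J"
proof -
  interpret prob_space M by fact
  let ?V = "\<lambda>i. correct X Y i -` {if i \<in> J then 1 else 0} \<inter> space M"
  have V: "prob (?V i) = (if i \<in> J then p i else 1 - p i)" if i: "i \<in> I" for i
  proof -
    let ?E = "{\<omega> \<in> space M. X i \<omega> = Y \<omega>}"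
    have "?E \<in> events" using i by measurable
    moreover have "?V i = (if i \<in> J then ?E else space M - ?E)"
      by (auto simp: correct_def split: if_splits)
    ultimately show ?thesis
      using p[OF i] prob_compl[of ?E] by simp
  qed
  show ?thesis
  proof (cases "I = {}")
    \<comment> \<open>Apart because an empty intersection is \<open>UNIV\<close>, not
      \<open>space M\<close>.\<close>
    case True
    then show ?thesis using \<open>J \<subseteq> I\<close> prob_space by (simp add: config_prob_def)
  next
    case False
    have "{\<omega> \<in> space M. {i \<in> I. X i \<omega> = Y \<omega>} = J} = (\<Inter>i\<in>I. ?V i)"
      using False \<open>J \<subseteq> I\<close> by (fastforce simp: correct_def split: if_splits)
    then have "prob {\<omega> \<in> space M. {i \<in> I. X i \<omega> = Y \<omega>} = J} = (\<Prod>i\<in>I. prob (?V i))"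
      using indep_varsD_finite[OF indep False \<open>finite I\<close>] by simp
    then show ?thesis
      by (simp add: V config_prob_def cong: prod.cong)
  qed
qed

theorem theorem1:
  fixes M :: "'a measure" and n :: nat
    and X :: "nat \<Rightarrow> 'a \<Rightarrow> real" and Y :: "'a \<Rightarrow> real" and p :: "nat \<Rightarrow> real"
  assumes "prob_space M"
    and "Y \<in> borel_measurable M"
    and "\<And>\<omega>. \<omega> \<in> space M \<Longrightarrow> Y \<omega> \<in> {-1, 1}"
    and "\<And>i. i \<in> {1..n} \<Longrightarrow> X i \<in> borel_measurable M"
    and "\<And>i \<omega>. \<lbrakk>i \<in> {1..n}; \<omega> \<in> space M\<rbrakk> \<Longrightarrow> X i \<omega> \<in> {-1, 1}"
    and "\<And>i. i \<in> {1..n} \<Longrightarrow> p i \<in> {0<..<1}"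
    and "\<And>i. i \<in> {1..n} \<Longrightarrow> measure M {\<omega> \<in> space M. X i \<omega> = Y \<omega>} = p i"
    and independence: "indep_experts M n X Y"
    and unbiased_truth: "measure M {\<omega> \<in> space M. Y \<omega> = 1} = 1/2"
      "measure M {\<omega> \<in> space M. Y \<omega> = -1} = 1/2"
  shows "measure M {\<omega> \<in> space M. opt_rule n p (\<lambda>i. X i \<omega>) \<noteq> Y \<omega>}
      \<le> exp (- (1/2) * potential n p) \<and>
    measure M {\<omega> \<in> space M. opt_rule n p (\<lambda>i. X i \<omega>) \<noteq> Y \<omega>}
      \<ge> 3 / (4 * (1 + exp (2 * potential n p + 4 * sqrt (potential n p))))"
proof -
  interpret prob_space M by fact
  let ?I = "{1..n}"
  let ?J = "\<lambda>\<omega>. {i \<in> ?I. X i \<omega> = Y \<omega>}"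
  let ?E = "\<lambda>J. {\<omega> \<in> space M. ?J \<omega> = J}"
  let ?bad = "{J \<in> Pow ?I. margin (weight \<circ> p) ?I J \<le> 0}"
  note [measurable] = assms(2,4)
  have error: "opt_rule n p (\<lambda>i. X i \<omega>) \<noteq> Y \<omega> \<longleftrightarrow> margin (weight \<circ> p) ?I (?J \<omega>) \<le> 0"
    if "\<omega> \<in> space M" for \<omega>
  proof -
    \<comment> \<open>This puts the margin in the form of \<open>opt_error_iff\<close>, ties
      included.\<close>
    have "margin (weight \<circ> p) ?I (?J \<omega>) =
        (\<Sum>i\<in>?I. 2 * (weight (p i) * correct X Y i \<omega>) - weight (p i))"
      unfolding margin_def by (intro sum.cong) (auto simp: correct_def)
    then show ?thesis
      using opt_error_iff[of Y \<omega> n X p] assms(3,5) that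
      unfolding sum_subtractf sum_distrib_left[symmetric] by auto
  qed
  have E: "?E J \<in> events" if "J \<in> Pow ?I" for J
  proof -
    have "?E J = {\<omega> \<in> space M. \<forall>i\<in>?I. X i \<omega> = Y \<omega> \<longleftrightarrow> i \<in> J}"
      using that by auto
    also have "\<dots> \<in> events"
      by measurable
    finally show ?thesis .
  qed
  \<comment> \<open>The error event splits into finitely many disjoint events, one for each bad set
    of correct experts.\<close>
  have "{\<omega> \<in> space M. opt_rule n p (\<lambda>i. X i \<omega>) \<noteq> Y \<omega>} = (\<Union>J\<in>?bad. ?E J)"
    using error by auto
  then have "prob {\<omega> \<in> space M. opt_rule n p (\<lambda>i. X i \<omega>) \<noteq> Y \<omega>} = (\<Sum>J\<in>?bad. prob (?E J))"
    using E by (simp only:) (rule finite_measure_finite_Union; auto simp: disjoint_family_on_def)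
  also have "\<dots> = error_prob p ?I"
    unfolding error_prob_def using assms independence[unfolded indep_experts_def]
    by (intro sum.cong refl prob_correct_set) auto
  finally show ?thesis
    using error_prob_upper[of ?I p] error_prob_lower[of ?I p] assms(6)
    by (simp add: potential_def)
qed

end
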